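(* Assume that the static fluid model described in the context is throughput optimal. Then, if either $I=2$ or $J=2$, the following holds for every vector $M=(M_p)_{p\in\mathcal P_0}\in\mathbb R_+^{|\mathcal P_0|}$ with $\|M\|$ small enough (that is, $\|M\|\le\delta$ for some $\delta>0$ determined by the static fluid model): setting $$x=x^*+\sum_{p\in\mathcal P_0}m_pM_p,$$ one has $$\sum_{(i,j)\in\mathcal E}\mu_{ij}\psi_{ij}\le\sum_{(i,j)\in\mathcal E}\mu_{ij}\psi^*_{ij}\qquad\text{for all }\psi\in\Xi(x,\nu).$$
   Context: Notation: $\|x\|=\sum_i|x_i|$. Static fluid model. $\mathcal I=\{1,\dots,I\}$ (classes), $\mathcal J=\{I+1,\dots,I+J\}$ (stations), $\mathcal E=\mathcal I\times\mathcal J$. Given are $\lambda_i\in(0,\infty)$ for $i\in\mathcal I$, $\nu_j\in(0,\infty)$ for $j\in\mathcal J$, $\mu_{ij}\in[0,\infty)$ for $(i,j)\in\mathcal E$; $\mathcal E_a=\{(i,j)\in\mathcal E:\mu_{ij}>0\}$ is the set of activities. Let $\bar\mu_{ij}=\mu_{ij}\nu_j$ and let $\Xi$ be the set of matrices $(\xi_{ij})_{(i,j)\in\mathcal E}$ with $\xi_{ij}\ge 0$ and $\sum_i\xi_{ij}\le 1$ for all $j$. It is assumed throughout that the static allocation problem "minimize $\rho$ over $\xi\in\Xi$ and $\rho$, subject to $\sum_j\bar\mu_{ij}\xi_{ij}=\lambda_i$ for all $i$ and $\sum_i\xi_{ij}\le\rho$ for all $j$" has a unique solution $(\xi^*,\rho^*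 )$, and that it satisfies: (1) $\rho^*=1$ and $\sum_i\xi^*_{ij}=1$ for all $j$; (2) the activities $(i,j)\in\mathcal E_a$ with $\xi^*_{ij}>0$ form a connected tree on the vertex set $\mathcal I\cup\mathcal J$. Put $\psi^*_{ij}=\xi^*_{ij}\nu_j$ and $x^*_i=\sum_j\psi^*_{ij}$. For $\bar x\in\mathbb R^I_+$, $\bar\nu\in\mathbb R^J_+$ let $\Xi(\bar x,\bar\nu)$ be the set of $(\psi_{ij})_{(i,j)\in\mathcal E}$ with $\psi_{ij}\ge0$, $\sum_i\psi_{ij}\le\bar\nu_j$ for all $j$, and $\sum_j\psi_{ij}\le\bar x_i$ for all $i$. The static fluid model is throughput optimal if $\sum_{(i,j)\in\mathcal E}\mu_{ij}\psi_{ij}\le\sum_{i}\lambda_i$ for every $\psi\in\Xi(x^*,\nu)$. Simple paths. Let $\mathcal E_{ba}=\{(i,j)\in\mathcal E_a:\xi^*_{ij}>0\}$ (basic activities) and let $\mathcal G_{ba}$ be the (tree) graph on $\mathcal I\cup\mathcal J$ with edge set $\mathcal E_{ba}$; edges are undirected, $(i,j)$ being identified with $(j,i)$. A basic path is a subgraph $q$ of $\mathcal G_{ba}$ with $2k+2$ distinct vertices $i_0,\dots,i_k\in\mathcal I$, $j_0,\dots,j_k\in\mathcal J$, $k\ge1$, and edges $(i_0,j_0),(j_0,i_1),(i_1,j_1),\dots,(j_{k-1},i_k),(i_k,j_k)$. If $(i_0,j_k)\in\mathcal E_a$ then $q$ together with the extra edge $(i_0,j_k)$ is called a closed simple path; if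 $(i_0,j_k)\notin\mathcal E_a$ then $q$ itself is called an open simple path. A simple path is a closed or an open simple path; $\mathcal E_p$ denotes the edge set of the simple path $p$. For an edge $(i,j)\in\mathcal E_p$ put $s(p,i,j)=+1$ if $(i,j)=(i_l,j_l)$ for some $0\le l\le k$; $s(p,i,j)=-1$ if $(i,j)=(i_l,j_{l-1})$ for some $1\le l\le k$; and, for closed $p$, $s(p,i_0,j_k)=-1$. Put $m_{i,p}=\sum_{j:(i,j)\in\mathcal E_p}s(p,i,j)\mu_{ij}$ (empty sums are $0$), $m_p=(m_{i,p})_{i\in\mathcal I}$, and $\mu(p)=\sum_{(i,j)\in\mathcal E_p}s(p,i,j)\mu_{ij}$. $\mathcal P_0$ is the set of simple paths $p$ with $\mu(p)=0$ (zero paths). *)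

theory Defs
  imports Complex_Main "HOL-Library.Cardinality"
begin

text \<open>
  Classes are the elements of a finite type \<open>'i\<close>, stations those of a finite type \<open>'j\<close>; the
  disjoint vertex set consisting of the classes and the stations is the sum type \<open>'i + 'j\<close>.
\<close>

subsection \<open>Undirected trees\<close>

text \<open>
  A simple undirected graph whose vertex set is the whole type is given by its symmetric,
  irreflexive adjacency relation.
  (In the AFP entry \<open>Graph_Theory\<close> a \<open>tree\<close> has no \<^emph>\<open>directed\<close> cycle. This does not fit here: with all
  arcs oriented from class to station nothing is excluded, while in a symmetric digraph every edge
  counts as a cycle of length two.)
\<close>

definition is_cycle :: "('v \<times> 'v) set \<Rightarrow> 'v list \<Rightarrow> bool" where
  "is_cycle R c \<longleftrightarrow> 3 \<le> length c \<and> distinct c \<and>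
     (\<forall>k<length c. (c ! k, c ! (Suc k mod length c)) \<in> R)"

definition is_tree :: "('v \<times> 'v) set \<Rightarrow> bool" where
  "is_tree R \<longleftrightarrow> sym R \<and> irrefl R \<and> (\<forall>u v. (u, v) \<in> R\<^sup>*) \<and> (\<nexists>c. is_cycle R c)"

definition bip_adj :: "('i \<times> 'j) set \<Rightarrow> (('i + 'j) \<times> ('i + 'j)) set" where
  "bip_adj E = (\<Union>(i, j)\<in>E. {(Inl i, Inr j), (Inr j, Inl i)})"

subsection \<open>The static fluid model\<close>

definition activities :: "('i \<Rightarrow> 'j \<Rightarrow> real) \<Rightarrow> ('i \<times> 'j) set" where
  "activities \<mu> = {(i, j). \<mu> i j > 0}"

definition basic_activities ::
    "('i \<Rightarrow> 'j \<Rightarrow> real) \<Rightarrow> ('i \<Rightarrow> 'j \<Rightarrow> real) \<Rightarrow> ('i \<times> 'j) set" where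
  "basic_activities \<mu> \<xi> = {(i, j) \<in> activities \<mu>. \<xi> i j > 0}"

definition Xi :: "('i::finite \<Rightarrow> 'j::finite \<Rightarrow> real) set" where
  "Xi = {\<xi>. (\<forall>i j. \<xi> i j \<ge> 0) \<and> (\<forall>j. (\<Sum>i\<in>UNIV. \<xi> i j) \<le> 1)}"

definition sap_feasible ::
    "('i::finite \<Rightarrow> real) \<Rightarrow> ('j::finite \<Rightarrow> real) \<Rightarrow> ('i \<Rightarrow> 'j \<Rightarrow> real)
      \<Rightarrow> ('i \<Rightarrow> 'j \<Rightarrow> real) \<times> real \<Rightarrow> bool" where
  "sap_feasible lam \<nu> \<mu> = (\<lambda>(\<xi>, \<rho>). \<xi> \<in> Xi \<and>
     (\<forall>i. (\<Sum>j\<in>UNIV. (\<mu> i j * \<nu> j) * \<xi> i j) = lam i) \<and>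
     (\<forall>j. (\<Sum>i\<in>UNIV. \<xi> i j) \<le> \<rho>))"

locale static_fluid_model =
  fixes lam :: "'i::finite \<Rightarrow> real"
    and \<nu> :: "'j::finite \<Rightarrow> real"
    and \<mu> :: "'i \<Rightarrow> 'j \<Rightarrow> real"
    and \<xi>s :: "'i \<Rightarrow> 'j \<Rightarrow> real"
    and \<rho>s :: real
  assumes lam_pos: "\<And>i. lam i > 0"
    and nu_pos: "\<And>j. \<nu> j > 0"
    and mu_nonneg: "\<And>i j. \<mu> i j \<ge> 0"
    and sap_unique_solution: "{s. is_arg_min snd (sap_feasible lam \<nu> \<mu>) s} = {(\<xi>s, \<rho>s)}"
    and critical_load: "\<rho>s = 1"
    and full_occupation: "\<And>j. (\<Sum>i\<in>UNIV. \<xi>s i j) = 1"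
    and basic_tree: "is_tree (bip_adj (basic_activities \<mu> \<xi>s))"

definition psi_star :: "('j \<Rightarrow> real) \<Rightarrow> ('i \<Rightarrow> 'j \<Rightarrow> real) \<Rightarrow> 'i \<Rightarrow> 'j \<Rightarrow> real" where
  "psi_star \<nu> \<xi>s i j = \<xi>s i j * \<nu> j"

definition x_star :: "('j::finite \<Rightarrow> real) \<Rightarrow> ('i \<Rightarrow> 'j \<Rightarrow> real) \<Rightarrow> 'i \<Rightarrow> real" where
  "x_star \<nu> \<xi>s i = (\<Sum>j\<in>UNIV. psi_star \<nu> \<xi>s i j)"

definition Xi_alloc ::
    "('i::finite \<Rightarrow> real) \<Rightarrow> ('j::finite \<Rightarrow> real) \<Rightarrow> ('i \<Rightarrow> 'j \<Rightarrow> real) set" where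
  "Xi_alloc x n = {\<psi>. (\<forall>i j. \<psi> i j \<ge> 0) \<and>
     (\<forall>j. (\<Sum>i\<in>UNIV. \<psi> i j) \<le> n j) \<and> (\<forall>i. (\<Sum>j\<in>UNIV. \<psi> i j) \<le> x i)}"

definition throughput :: "('i::finite \<Rightarrow> 'j::finite \<Rightarrow> real) \<Rightarrow> ('i \<Rightarrow> 'j \<Rightarrow> real) \<Rightarrow> real" where
  "throughput \<mu> \<psi> = (\<Sum>(i, j)\<in>UNIV. \<mu> i j * \<psi> i j)"

definition throughput_optimal ::
    "('i::finite \<Rightarrow> real) \<Rightarrow> ('j::finite \<Rightarrow> real) \<Rightarrow> ('i \<Rightarrow> 'j \<Rightarrow> real)
      \<Rightarrow> ('i \<Rightarrow> 'j \<Rightarrow> real) \<Rightarrow> bool" where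
  "throughput_optimal lam \<nu> \<mu> \<xi>s \<longleftrightarrow>
     (\<forall>\<psi>\<in>Xi_alloc (x_star \<nu> \<xi>s) \<nu>. throughput \<mu> \<psi> \<le> (\<Sum>i\<in>UNIV. lam i))"

subsection \<open>Simple paths\<close>

text \<open>
  A basic path is encoded as the list $[(i_0,j_0),\ldots,(i_k,j_k)]$, where $k \ge 1$. Such a path
  has one endpoint among the classes and one among the stations, so the subgraph determines this
  list. A basic path $q$ gives rise to exactly one simple path: $q$ with the edge $(i_0,j_k)$ added
  if that edge is an activity (closed), and $q$ itself otherwise (open). Conversely $q$ is the part
  of the simple path lying in the tree of basic activities, as that tree cannot contain the closing
  edge. Hence simple paths are encoded by the same lists.
\<close>

type_synonym ('i, 'j) path = "('i \<times> 'j) list"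

definition back_edges :: "('i, 'j) path \<Rightarrow> ('i \<times> 'j) set" where
  "back_edges p = {(fst (p ! Suc l), snd (p ! l)) |l. Suc l < length p}"

definition simple_paths ::
    "('i \<Rightarrow> 'j \<Rightarrow> real) \<Rightarrow> ('i \<Rightarrow> 'j \<Rightarrow> real) \<Rightarrow> ('i, 'j) path set" where
  "simple_paths \<mu> \<xi>s = {p. 2 \<le> length p \<and> distinct (map fst p) \<and> distinct (map snd p) \<and>
     set p \<subseteq> basic_activities \<mu> \<xi>s \<and> back_edges p \<subseteq> basic_activities \<mu> \<xi>s}"

definition closing_edges :: "('i \<Rightarrow> 'j \<Rightarrow> real) \<Rightarrow> ('i, 'j) path \<Rightarrow> ('i \<times> 'j) set" where
  "closing_edges \<mu> p = {(fst (hd p), snd (last p))} \<inter> activities \<mu>"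

definition path_edges :: "('i \<Rightarrow> 'j \<Rightarrow> real) \<Rightarrow> ('i, 'j) path \<Rightarrow> ('i \<times> 'j) set" where
  "path_edges \<mu> p = set p \<union> back_edges p \<union> closing_edges \<mu> p"

text \<open>Only used for edges of \<open>p\<close>.\<close>

definition path_sign :: "('i, 'j) path \<Rightarrow> 'i \<Rightarrow> 'j \<Rightarrow> real" where
  "path_sign p i j = (if (i, j) \<in> set p then 1 else - 1)"

definition path_drift ::
    "('i \<Rightarrow> 'j \<Rightarrow> real) \<Rightarrow> ('i, 'j) path \<Rightarrow> 'i \<Rightarrow> real" where
  "path_drift \<mu> p i = (\<Sum>j | (i, j) \<in> path_edges \<mu> p. path_sign p i j * \<mu> i j)"

definition path_weight :: "('i \<Rightarrow> 'j \<Rightarrow> real) \<Rightarrow> ('i, 'j) path \<Rightarrow> real" where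
  "path_weight \<mu> p = (\<Sum>(i, j)\<in>path_edges \<mu> p. path_sign p i j * \<mu> i j)"

definition zero_paths ::
    "('i \<Rightarrow> 'j \<Rightarrow> real) \<Rightarrow> ('i \<Rightarrow> 'j \<Rightarrow> real) \<Rightarrow> ('i, 'j) path set" where
  "zero_paths \<mu> \<xi>s = {p \<in> simple_paths \<mu> \<xi>s. path_weight \<mu> p = 0}"

text \<open>This rules out that a sum over all zero paths is \<open>0\<close> by the convention for infinite index sets.\<close>

lemma finite_zero_paths: "finite (zero_paths \<mu> \<xi>s)"
  for \<mu> \<xi>s :: "'i::finite \<Rightarrow> 'j::finite \<Rightarrow> real"
proof (rule finite_subset)
  show "zero_paths \<mu> \<xi>s \<subseteq> {p. set p \<subseteq> UNIV \<and> distinct p}"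
    by (auto simp: zero_paths_def simple_paths_def distinct_map)
  show "finite {p :: ('i, 'j) path. set p \<subseteq> UNIV \<and> distinct p}"
    by (rule finite_subset_distinct) simp
qed

end

theory Submission
  imports Defs
begin

text \<open>
  The proof is weak linear programming duality. Give each class \<open>i\<close> a price \<open>\<alpha> i \<ge> 0\<close> and each
  station \<open>j\<close> a price \<open>\<beta> j \<ge> 0\<close> such that \<open>\<mu> i j \<le> \<alpha> i + \<beta> j\<close> always, with equality wherever
  \<open>\<psi>\<^sup>*\<close> is positive. Then the dual value \<open>(\<Sum>i. \<alpha> i * x i) + (\<Sum>j. \<beta> j * \<nu> j)\<close> bounds the throughput
  for every \<open>x\<close> (\<open>throughput_le_dual_value\<close>), and at \<open>x = x\<^sup>*\<close> it equals the throughput of \<open>\<psi>\<^sup>*\<close>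
  (\<open>dual_value_x_star\<close>). Moving \<open>x\<close> away from \<open>x\<^sup>*\<close> along the drifts of zero paths can therefore raise
  the bound only if some zero path \<open>p\<close> has \<open>(\<Sum>i. \<alpha> i * m\<^sub>i\<^sub>p) > 0\<close>.

  Such prices come from throughput optimality (\<open>dual_prices\<close>). Since the basic activities connect all
  vertices, any vertex is reached from a fixed class by a walk along them. The throughput of the
  alternating sum of the edges of such a walk is, up to sign and a common shift, the price of the vertex, and the price
  inequalities say that no circulation that can be added to \<open>\<psi>\<^sup>*\<close> gains throughput.

  If there are only two classes or only two stations, a zero path consists of classes \<open>a, c\<close> and
  stations \<open>b, d\<close> with basic edges \<open>ab\<close>, \<open>cb\<close>, \<open>cd\<close>. On these edges \<open>\<mu>\<close> is the sum of the two prices, and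
  \<open>\<mu>(p) = 0\<close> says that the same is true of the closing edge \<open>ad\<close>. Hence the price of the drift is
  \<open>\<alpha>\<^sub>a * (\<beta>\<^sub>b - \<beta>\<^sub>d) + \<alpha>\<^sub>c * (\<beta>\<^sub>d - \<beta>\<^sub>b) = (\<alpha>\<^sub>a - \<alpha>\<^sub>c) * (\<beta>\<^sub>b - \<beta>\<^sub>d) = \<mu>\<^sub>a\<^sub>d * \<mu>\<^sub>c\<^sub>b - \<mu>\<^sub>a\<^sub>b * \<mu>\<^sub>c\<^sub>d\<close>.
  The sign of this expression is decided by the static allocation problem: if it were positive,
  shifting work around the four-cycle would serve the same load with less effort, against the
  uniqueness of its solution (\<open>basic_path_exchange\<close>). So no zero path raises the dual value.
\<close>

section \<open>Perturbing allocations\<close>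

definition unit_alloc :: "'i \<Rightarrow> 'j \<Rightarrow> 'i \<Rightarrow> 'j \<Rightarrow> real" where
  "unit_alloc a b i j = (if i = a \<and> j = b then 1 else 0)"

lemma unit_alloc_row:
  fixes f :: "'j::finite \<Rightarrow> real"
  shows "(\<Sum>j\<in>UNIV. f j * unit_alloc a b i j) = (if i = a then f b else 0)"
  by (cases "i = a") (simp_all add: unit_alloc_def if_distrib[of "\<lambda>u. _ * u"] cong: if_cong)

lemma unit_alloc_column:
  fixes f :: "'i::finite \<Rightarrow> real"
  shows "(\<Sum>i\<in>UNIV. f i * unit_alloc a b i j) = (if j = b then f a else 0)"
  by (cases "j = b") (simp_all add: unit_alloc_def if_distrib[of "\<lambda>u. _ * u"] cong: if_cong)

lemmas unit_alloc_row_1 = unit_alloc_row[of "\<lambda>_. 1", simplified]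
lemmas unit_alloc_column_1 = unit_alloc_column[of "\<lambda>_. 1", simplified]

lemma throughput_iterated:
  "throughput \<mu> \<psi> = (\<Sum>i\<in>UNIV. \<Sum>j\<in>UNIV. \<mu> i j * \<psi> i j)"
  unfolding throughput_def by (simp add: sum.cartesian_product)

lemma throughput_add:
  "throughput \<mu> (\<lambda>i j. \<phi> i j + \<psi> i j) = throughput \<mu> \<phi> + throughput \<mu> \<psi>"
  by (simp add: throughput_iterated algebra_simps sum.distrib)

lemma throughput_scale:
  "throughput \<mu> (\<lambda>i j. c * \<psi> i j) = c * throughput \<mu> \<psi>"
  by (simp add: throughput_iterated algebra_simps sum_distrib_left)

lemma throughput_diff:
  "throughput \<mu> (\<lambda>i j. \<phi> i j - \<psi> i j) = throughput \<mu> \<phi> - throughput \<mu> \<psi>"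
  by (simp add: throughput_iterated algebra_simps sum_subtractf)

lemma throughput_unit_alloc: "throughput \<mu> (unit_alloc a b) = \<mu> a b"
  by (simp add: throughput_iterated unit_alloc_row)

text \<open>
  There are finitely many entries, and each one that decreases along \<open>d\<close> starts from a positive
  value; so no step up to the smallest of the ratios \<open>\<psi> i j / \<bar>d i j\<bar>\<close> makes an entry negative.
\<close>

lemma nonneg_step:
  fixes \<psi> d :: "'i::finite \<Rightarrow> 'j::finite \<Rightarrow> real"
  assumes nonneg: "\<And>i j. \<psi> i j \<ge> 0"
    and inward: "\<And>i j. \<psi> i j = 0 \<Longrightarrow> d i j \<ge> 0"
  shows "\<exists>\<epsilon>>0. \<forall>i j. \<psi> i j + \<epsilon> * d i j \<ge> 0"
proof -
  \<comment> \<open>The value 1 keeps the set nonempty.\<close>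
  define S where "S = insert 1 ((\<lambda>(i, j). \<psi> i j / \<bar>d i j\<bar>) ` {(i, j). d i j < 0})"
  have fin: "finite S" unfolding S_def by simp
  have "\<psi> i j > 0" if "d i j < 0" for i j
    using that nonneg[of i j] inward[of i j] by linarith
  then have "\<forall>s\<in>S. s > 0" by (auto simp: S_def divide_pos_neg)
  moreover have "S \<noteq> {}" by (simp add: S_def)
  ultimately have pos: "Min S > 0" using fin by simp
  have "\<psi> i j + Min S * d i j \<ge> 0" for i j
  proof (cases "d i j < 0")
    case True
    then have "Min S \<le> \<psi> i j / \<bar>d i j\<bar>"
      using fin unfolding S_def by (intro Min_le) force+
    with True show ?thesis by (simp add: field_simps)
  next
    case False
    then show ?thesis using nonneg pos by simp
  qed
  with pos show ?thesis by blast
qed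

section \<open>Consequences of the two optimality assumptions\<close>

context static_fluid_model
begin

lemma xi_star_optimal: "is_arg_min snd (sap_feasible lam \<nu> \<mu>) (\<xi>s, 1)"
  using sap_unique_solution critical_load by auto

lemma xi_star_nonneg: "\<xi>s i j \<ge> 0"
  and xi_star_serves: "(\<Sum>j\<in>UNIV. (\<mu> i j * \<nu> j) * \<xi>s i j) = lam i"
  using xi_star_optimal by (auto simp: is_arg_min_def sap_feasible_def Xi_def)

lemma psi_star_nonneg: "psi_star \<nu> \<xi>s i j \<ge> 0"
  unfolding psi_star_def by (intro mult_nonneg_nonneg xi_star_nonneg less_imp_le[OF nu_pos])

lemma psi_star_column: "(\<Sum>i\<in>UNIV. psi_star \<nu> \<xi>s i j) = \<nu> j"
  using full_occupation by (simp add: psi_star_def flip: sum_distrib_right)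

lemma throughput_psi_star: "throughput \<mu> (psi_star \<nu> \<xi>s) = (\<Sum>i\<in>UNIV. lam i)"
  unfolding throughput_iterated psi_star_def xi_star_serves[symmetric]
  by (simp add: mult.assoc mult.left_commute mult.commute)

text \<open>
  A small step from \<open>\<xi>\<^sup>*\<close> in such a direction serves the same load without exceeding
  \<open>\<rho> = 1\<close>, hence is another optimal solution unless the direction is zero. This is how the uniqueness
  of the static allocation enters.
\<close>

lemma sap_no_free_direction:
  assumes rows: "\<And>i. (\<Sum>j\<in>UNIV. (\<mu> i j * \<nu> j) * d i j) = 0"
    and columns: "\<And>j. (\<Sum>i\<in>UNIV. d i j) \<le> 0"
    and inward: "\<And>i j. \<xi>s i j = 0 \<Longrightarrow> d i j \<ge> 0"
  shows "d i j = 0"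
proof -
  obtain \<epsilon> where \<epsilon>: "\<epsilon> > 0" "\<And>i j. \<xi>s i j + \<epsilon> * d i j \<ge> 0"
    using nonneg_step[of \<xi>s d] xi_star_nonneg inward by blast
  define \<xi> where "\<xi> = (\<lambda>i j. \<xi>s i j + \<epsilon> * d i j)"
  have col: "(\<Sum>i\<in>UNIV. \<xi> i j) \<le> 1" for j
  proof -
    have "(\<Sum>i\<in>UNIV. \<xi> i j) = 1 + \<epsilon> * (\<Sum>i\<in>UNIV. d i j)"
      unfolding \<xi>_def sum.distrib full_occupation sum_distrib_left ..
    then show ?thesis using \<epsilon>(1) columns[of j] by (simp add: mult_nonneg_nonpos)
  qed
  have row: "(\<Sum>j\<in>UNIV. (\<mu> i j * \<nu> j) * \<xi> i j) = lam i" for i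
  proof -
    have "(\<Sum>j\<in>UNIV. (\<mu> i j * \<nu> j) * \<xi> i j)
      = lam i + \<epsilon> * (\<Sum>j\<in>UNIV. (\<mu> i j * \<nu> j) * d i j)"
      unfolding xi_star_serves[of i, symmetric] sum_distrib_left sum.distrib[symmetric]
      by (rule sum.cong) (simp_all add: \<xi>_def algebra_simps)
    then show ?thesis by (simp add: rows)
  qed
  have "sap_feasible lam \<nu> \<mu> (\<xi>, 1)"
    using \<epsilon>(2) col row by (simp add: sap_feasible_def Xi_def \<xi>_def)
  then have "is_arg_min snd (sap_feasible lam \<nu> \<mu>) (\<xi>, 1)"
    using xi_star_optimal by (simp add: is_arg_min_def)
  then have "(\<xi>, 1) \<in> {s. is_arg_min snd (sap_feasible lam \<nu> \<mu>) s}" by simp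
  then have "\<xi> = \<xi>s" unfolding sap_unique_solution by simp
  then have "\<xi> i j = \<xi>s i j" by simp
  then show ?thesis using \<epsilon>(1) by (simp add: \<xi>_def)
qed

text \<open>
  Let class \<open>a\<close> move some of its work from station \<open>b\<close> to \<open>d\<close>, and class \<open>c\<close> move some from \<open>d\<close> to
  \<open>b\<close>, so that station \<open>d\<close> and the load served of both classes stay balanced. If the inequality
  failed, station \<open>b\<close> would not become busier.
\<close>

lemma basic_path_exchange:
  assumes "(a, b) \<in> basic_activities \<mu> \<xi>s" "(c, b) \<in> basic_activities \<mu> \<xi>s"
    and "(c, d) \<in> basic_activities \<mu> \<xi>s" and "a \<noteq> c" "b \<noteq> d"
  shows "\<mu> a d * \<mu> c b \<le> \<mu> a b * \<mu> c d"
proof (rule ccontr)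
  assume "\<not> ?thesis"
  then have gain: "\<mu> a b * \<mu> c d < \<mu> a d * \<mu> c b" by simp
  have pos: "\<mu> a b > 0" "\<mu> c b > 0" "\<mu> c d > 0" "\<xi>s a b > 0" "\<xi>s c b > 0" "\<xi>s c d > 0"
    using assms by (auto simp: basic_activities_def activities_def)
  \<comment> \<open>Up to sign, the rates of change on \<open>ad\<close>, \<open>cd\<close> (both \<open>P\<close>), \<open>ab\<close> (\<open>Q\<close>) and \<open>cb\<close> (\<open>R\<close>) are fixed
    up to a common factor by the two load balances and the occupation of \<open>d\<close>; the factor clears
    denominators.\<close>
  define P where "P = \<mu> a b * \<mu> c b * \<nu> b"
  define Q where "Q = \<mu> a d * \<mu> c b * \<nu> d"
  define R where "R = \<mu> a b * \<mu> c d * \<nu> d"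
  define D where "D = (\<lambda>i j. P * unit_alloc a d i j - P * unit_alloc c d i j
    - Q * unit_alloc a b i j + R * unit_alloc c b i j)"
  have P: "P > 0" and R: "R > 0" using pos nu_pos by (simp_all add: P_def R_def)
  have QR: "R \<le> Q" using gain nu_pos[of d] by (simp add: Q_def R_def mult_right_mono)
  have "D a d = 0"
  proof (rule sap_no_free_direction)
    fix i
    have "(\<Sum>j\<in>UNIV. (\<mu> i j * \<nu> j) * D i j) =
        P * (\<Sum>j\<in>UNIV. (\<mu> i j * \<nu> j) * unit_alloc a d i j)
      - P * (\<Sum>j\<in>UNIV. (\<mu> i j * \<nu> j) * unit_alloc c d i j)
      - Q * (\<Sum>j\<in>UNIV. (\<mu> i j * \<nu> j) * unit_alloc a b i j)
      + R * (\<Sum>j\<in>UNIV. (\<mu> i j * \<nu> j) * unit_alloc c b i j)"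
      unfolding D_def sum_distrib_left sum_subtractf[symmetric] sum.distrib[symmetric]
      by (rule sum.cong) (simp_all add: algebra_simps)
    also have "\<dots> = 0"
      using assms(4) by (simp add: unit_alloc_row P_def Q_def R_def)
    finally show "(\<Sum>j\<in>UNIV. (\<mu> i j * \<nu> j) * D i j) = 0" .
  next
    fix j
    have "(\<Sum>i\<in>UNIV. D i j) = (if j = b then R - Q else 0)"
      using assms(5)
      by (simp add: D_def sum.distrib sum_subtractf unit_alloc_column)
    then show "(\<Sum>i\<in>UNIV. D i j) \<le> 0" using QR by simp
  next
    fix i j assume "\<xi>s i j = 0"
    then have "\<not> (i = a \<and> j = b)" "\<not> (i = c \<and> j = b)" "\<not> (i = c \<and> j = d)"
      using pos by auto
    then show "D i j \<ge> 0" using P R assms(4,5) by (auto simp: D_def unit_alloc_def)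
  qed
  moreover have "D a d = P" using assms(4,5) by (simp add: D_def unit_alloc_def)
  ultimately show False using P by simp
qed

text \<open>
  A circulation changes no row or column sum. If it is negative only where \<open>\<psi>\<^sup>*\<close> is positive, a small
  step along it keeps \<open>\<psi>\<^sup>*\<close> feasible for \<open>x\<^sup>*\<close>, where \<open>\<psi>\<^sup>*\<close> already has the greatest throughput.
\<close>

lemma circulation_throughput:
  assumes opt: "throughput_optimal lam \<nu> \<mu> \<xi>s"
    and rows: "\<And>i. (\<Sum>j\<in>UNIV. d i j) = 0"
    and columns: "\<And>j. (\<Sum>i\<in>UNIV. d i j) = 0"
    and inward: "\<And>i j. psi_star \<nu> \<xi>s i j = 0 \<Longrightarrow> d i j \<ge> 0"
  shows "throughput \<mu> d \<le> 0"
proof -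
  obtain \<epsilon> where \<epsilon>: "\<epsilon> > 0" "\<And>i j. psi_star \<nu> \<xi>s i j + \<epsilon> * d i j \<ge> 0"
    using nonneg_step[of "psi_star \<nu> \<xi>s" d] psi_star_nonneg inward by blast
  have "(\<lambda>i j. psi_star \<nu> \<xi>s i j + \<epsilon> * d i j) \<in> Xi_alloc (x_star \<nu> \<xi>s) \<nu>"
    using \<epsilon>(2) rows columns
    by (simp add: Xi_alloc_def x_star_def sum.distrib psi_star_column flip: sum_distrib_left)
  then have "throughput \<mu> (\<lambda>i j. psi_star \<nu> \<xi>s i j + \<epsilon> * d i j)
      \<le> throughput \<mu> (psi_star \<nu> \<xi>s)"
    using opt by (simp add: throughput_optimal_def throughput_psi_star)
  then show ?thesis
    using \<epsilon>(1) by (simp add: throughput_add throughput_scale mult_le_0_iff)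
qed

section \<open>Dual prices\<close>

text \<open>
  For a walk from class \<open>r\<close> to the vertex \<open>v\<close>, let \<open>d\<close> be the alternating sum of its edges: steps from
  class to station count \<open>+1\<close>, steps back \<open>-1\<close>. Only what is needed of \<open>d\<close> is recorded: a bound on its support
  and its row and column sums. They determine \<open>d\<close> up to a circulation on the support of \<open>\<psi>\<^sup>*\<close>.
\<close>

definition transports :: "'i \<Rightarrow> 'i + 'j \<Rightarrow> ('i \<Rightarrow> 'j \<Rightarrow> real) \<Rightarrow> bool" where
  "transports r v d \<longleftrightarrow> (\<forall>i j. psi_star \<nu> \<xi>s i j = 0 \<longrightarrow> d i j = 0) \<and>
    (\<forall>i. (\<Sum>j\<in>UNIV. d i j) = of_bool (i = r) - of_bool (Inl i = v)) \<and>
    (\<forall>j. (\<Sum>i\<in>UNIV. d i j) = of_bool (Inr j = v))"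

lemma transport_along_tree: "\<exists>d. transports r v d"
proof -
  have basic: "psi_star \<nu> \<xi>s i j \<noteq> 0" if "(i, j) \<in> basic_activities \<mu> \<xi>s" for i j
    using that nu_pos[of j] by (auto simp: basic_activities_def psi_star_def)
  have "(Inl r, v) \<in> (bip_adj (basic_activities \<mu> \<xi>s))\<^sup>*"
    using basic_tree by (simp add: is_tree_def)
  then show ?thesis
  proof (induction rule: rtrancl_induct)
    case base
    show ?case by (rule exI[of _ "\<lambda>_ _. 0"]) (auto simp: transports_def)
  next
    case (step u v)
    then obtain d :: "'i \<Rightarrow> 'j \<Rightarrow> real"
      where d: "\<And>i j. psi_star \<nu> \<xi>s i j = 0 \<Longrightarrow> d i j = 0"
      "\<And>i. (\<Sum>j\<in>UNIV. d i j) = of_bool (i = r) - of_bool (Inl i = u)"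
      "\<And>j. (\<Sum>i\<in>UNIV. d i j) = of_bool (Inr j = u)"
      by (auto simp: transports_def)
    from step.hyps(2) consider
      (down) a b where "(a, b) \<in> basic_activities \<mu> \<xi>s" "u = Inl a" "v = Inr b"
      | (up) a b where "(a, b) \<in> basic_activities \<mu> \<xi>s" "u = Inr b" "v = Inl a"
      by (auto simp: bip_adj_def)
    then show ?case
    proof cases
      case down
      show ?thesis
        using d down basic[OF down(1)]
        by (intro exI[of _ "\<lambda>i j. d i j + unit_alloc a b i j"])
           (auto simp: transports_def sum.distrib unit_alloc_row_1 unit_alloc_column_1, auto simp: unit_alloc_def)
    next
      case up
      show ?thesis
        using d up basic[OF up(1)]
        by (intro exI[of _ "\<lambda>i j. d i j - unit_alloc a b i j"])
           (auto simp: transports_def sum_subtractf unit_alloc_row_1 unit_alloc_column_1, auto simp: unit_alloc_def)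
    qed
  qed
qed

text \<open>
  The transports to a class \<open>a\<close> and to a station \<open>b\<close> differ, up to the edge \<open>(a, b)\<close>, by a circulation.
  Its throughput is the reduced cost \<open>\<mu> a b - (\<alpha> a + \<beta> b)\<close>, so that cost is at most 0; where
  \<open>\<psi>\<^sup>*\<close> is positive the circulation may also be reversed, and the cost vanishes. Adding a constant
  to \<open>\<alpha>\<close> and subtracting it from \<open>\<beta>\<close> preserves all this. Such a shift makes both price vectors
  nonnegative because \<open>\<alpha> a + \<beta> b \<ge> \<mu> a b \<ge> 0\<close> for all \<open>a\<close> and \<open>b\<close>.
\<close>

lemma dual_prices:
  assumes opt: "throughput_optimal lam \<nu> \<mu> \<xi>s"
  shows "\<exists>\<alpha> \<beta>. (\<forall>i. \<alpha> i \<ge> 0) \<and> (\<forall>j. \<beta> j \<ge> 0) \<and> (\<forall>i j. \<mu> i j \<le> \<alpha> i + \<beta> j) \<and>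
    (\<forall>i j. psi_star \<nu> \<xi>s i j > 0 \<longrightarrow> \<alpha> i + \<beta> j = \<mu> i j)"
proof -
  fix r :: 'i
  obtain F where "\<And>v. transports r v (F v)"
    using transport_along_tree by metis
  then have F: "\<And>v i j. psi_star \<nu> \<xi>s i j = 0 \<Longrightarrow> F v i j = 0"
      "\<And>v i. (\<Sum>j\<in>UNIV. F v i j) = of_bool (i = r) - of_bool (Inl i = v)"
      "\<And>v j. (\<Sum>i\<in>UNIV. F v i j) = of_bool (Inr j = v)"
    unfolding transports_def by blast+
  define \<alpha> where "\<alpha> i = - throughput \<mu> (F (Inl i))" for i
  define \<beta> where "\<beta> j = throughput \<mu> (F (Inr j))" for j
  define C where "C a b = (\<lambda>i j. (F (Inl a) i j - F (Inr b) i j) + unit_alloc a b i j)" for a b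
  have C: "throughput \<mu> (C a b) = \<mu> a b - (\<alpha> a + \<beta> b)" for a b
    by (simp add: C_def throughput_add throughput_diff throughput_unit_alloc \<alpha>_def \<beta>_def)
  have Crow: "(\<Sum>j\<in>UNIV. C a b i j) = 0" and Ccol: "(\<Sum>i\<in>UNIV. C a b i j) = 0" for a b i j
    by (auto simp: C_def sum.distrib sum_subtractf F unit_alloc_row_1 unit_alloc_column_1)
  have feas: "\<mu> a b \<le> \<alpha> a + \<beta> b" for a b
  proof -
    have "throughput \<mu> (C a b) \<le> 0"
      using opt Crow Ccol
      by (rule circulation_throughput) (simp add: C_def F unit_alloc_def)
    then show ?thesis by (simp add: C)
  qed
  have tight: "\<alpha> a + \<beta> b = \<mu> a b" if "psi_star \<nu> \<xi>s a b > 0" for a b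
  proof -
    have "throughput \<mu> (\<lambda>i j. (-1) * C a b i j) \<le> 0"
      using opt
    proof (rule circulation_throughput)
      show "(\<Sum>j\<in>UNIV. (-1) * C a b i j) = 0" for i
        using Crow by (simp add: sum_negf)
      show "(\<Sum>i\<in>UNIV. (-1) * C a b i j) = 0" for j
        using Ccol by (simp add: sum_negf)
      show "(-1) * C a b i j \<ge> 0" if "psi_star \<nu> \<xi>s i j = 0" for i j
        using that \<open>psi_star \<nu> \<xi>s a b > 0\<close> by (auto simp: C_def F unit_alloc_def)
    qed
    then show ?thesis using feas[of a b] unfolding throughput_scale C by simp
  qed
  \<comment> \<open>The shift by \<open>t\<close> makes the least station price 0.\<close>
  define t where "t = Min (range \<beta>)"
  have t_le: "t \<le> \<beta> j" for j by (simp add: t_def)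
  have "t \<in> range \<beta>" unfolding t_def by (rule Min_in) auto
  then obtain b where b: "t = \<beta> b" by blast
  have "\<alpha> i + t \<ge> 0" for i
    using feas[of i b] mu_nonneg[of i b] b by simp
  with t_le feas tight show ?thesis
    by (intro exI[of _ "\<lambda>i. \<alpha> i + t"] exI[of _ "\<lambda>j. \<beta> j - t"]) auto
qed

end

text \<open>
  Weak duality.
\<close>

lemma throughput_le_dual_value:
  fixes \<psi> :: "'i::finite \<Rightarrow> 'j::finite \<Rightarrow> real"
  assumes \<psi>: "\<psi> \<in> Xi_alloc x n"
    and \<alpha>: "\<And>i. \<alpha> i \<ge> 0" and \<beta>: "\<And>j. \<beta> j \<ge> 0"
    and feas: "\<And>i j. \<mu> i j \<le> \<alpha> i + \<beta> j"
  shows "throughput \<mu> \<psi> \<le> (\<Sum>i\<in>UNIV. \<alpha> i * x i) + (\<Sum>j\<in>UNIV. \<beta> j * n j)"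
proof -
  have "throughput \<mu> \<psi> \<le> throughput (\<lambda>i j. \<alpha> i + \<beta> j) \<psi>"
    using \<psi> feas unfolding throughput_iterated Xi_alloc_def
    by (auto intro!: sum_mono mult_right_mono)
  also have "\<dots> = (\<Sum>i\<in>UNIV. \<alpha> i * (\<Sum>j\<in>UNIV. \<psi> i j)) + (\<Sum>j\<in>UNIV. \<beta> j * (\<Sum>i\<in>UNIV. \<psi> i j))"
    unfolding throughput_iterated distrib_right sum.distrib sum_distrib_left
    by (simp add: sum.swap[of "\<lambda>i j. \<beta> j * \<psi> i j"])
  also have "\<dots> \<le> (\<Sum>i\<in>UNIV. \<alpha> i * x i) + (\<Sum>j\<in>UNIV. \<beta> j * n j)"
    using \<psi> \<alpha> \<beta> unfolding Xi_alloc_def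
    by (auto intro!: add_mono sum_mono mult_left_mono)
  finally show ?thesis .
qed

section \<open>Short simple paths\<close>

lemma simple_path_length_le:
  fixes p :: "('i::finite, 'j::finite) path"
  assumes "p \<in> simple_paths \<mu> \<xi>s"
  shows "length p \<le> CARD('i)" "length p \<le> CARD('j)"
  using assms distinct_card[of "map fst p"] distinct_card[of "map snd p"]
    card_mono[of UNIV "set (map fst p)"] card_mono[of UNIV "set (map snd p)"]
  by (auto simp: simple_paths_def)

lemma sum_path_drift:
  fixes p :: "('i::finite, 'j::finite) path"
  shows "(\<Sum>i\<in>UNIV. f i * path_drift \<mu> p i) =
    (\<Sum>(i, j)\<in>path_edges \<mu> p. f i * (path_sign p i j * \<mu> i j))"
proof -
  have "(\<Sum>i\<in>UNIV. f i * path_drift \<mu> p i) =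
    (\<Sum>i\<in>UNIV. \<Sum>j | (i, j) \<in> path_edges \<mu> p. f i * (path_sign p i j * \<mu> i j))"
    by (simp add: path_drift_def sum_distrib_left)
  also have "\<dots> = (\<Sum>(i, j)\<in>(SIGMA i:UNIV. {j. (i, j) \<in> path_edges \<mu> p}).
      f i * (path_sign p i j * \<mu> i j))"
    by (rule sum.Sigma) auto
  also have "(SIGMA i:UNIV. {j. (i, j) \<in> path_edges \<mu> p}) = path_edges \<mu> p" by auto
  finally show ?thesis .
qed

text \<open>
  The closing edge \<open>(a, d)\<close> is an edge of the path only if \<open>\<mu> a d > 0\<close>. As its coefficient is a
  multiple of \<open>\<mu> a d\<close>, closed and open paths obey one formula.
\<close>

lemma sum_path_edges_two:
  fixes \<mu> :: "'i \<Rightarrow> 'j \<Rightarrow> real"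
  assumes "a \<noteq> c" "b \<noteq> d" "\<mu> a d \<ge> 0"
  shows "(\<Sum>(i, j)\<in>path_edges \<mu> [(a, b), (c, d)]. f i * (path_sign [(a, b), (c, d)] i j * \<mu> i j))
    = f a * (\<mu> a b - \<mu> a d) + f c * (\<mu> c d - \<mu> c b)"
proof -
  have back_eq: "back_edges [(a, b), (c, d)] = {(c, b)}"
    by (auto simp: back_edges_def)
  show ?thesis
  proof (cases "\<mu> a d = 0")
    case True
    then have "path_edges \<mu> [(a, b), (c, d)] = {(a, b), (c, d), (c, b)}"
      by (auto simp: path_edges_def back_eq closing_edges_def activities_def)
    then show ?thesis using assms True by (simp add: path_sign_def algebra_simps)
  next
    case False
    then have "path_edges \<mu> [(a, b), (c, d)] = {(a, b), (c, d), (c, b), (a, d)}"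
      using assms by (auto simp: path_edges_def back_eq closing_edges_def activities_def)
    then show ?thesis using assms by (simp add: path_sign_def algebra_simps)
  qed
qed

context static_fluid_model
begin

text \<open>
  The price of the drift factors as \<open>(\<alpha> a - \<alpha> c) * (\<beta> b - \<beta> d)\<close>, and the exchange inequality for
  the four rates \<open>\<mu> i j = \<alpha> i + \<beta> j\<close> is the statement that this product is at most 0.
\<close>

lemma short_zero_path_dual_drift:
  assumes p: "p \<in> zero_paths \<mu> \<xi>s" and len: "length p \<le> 2"
    and tight: "\<And>i j. psi_star \<nu> \<xi>s i j > 0 \<Longrightarrow> \<alpha> i + \<beta> j = \<mu> i j"
  shows "(\<Sum>i\<in>UNIV. \<alpha> i * path_drift \<mu> p i) \<le> 0"
proof -
  have "length p = Suc (Suc 0)" using p len by (auto simp: zero_paths_def simple_paths_def)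
  then obtain a b c d where p_eq: "p = [(a, b), (c, d)]"
    by (auto simp: length_Suc_conv)
  have ne: "a \<noteq> c" "b \<noteq> d" and
    basic: "(a, b) \<in> basic_activities \<mu> \<xi>s" "(c, d) \<in> basic_activities \<mu> \<xi>s"
      "(c, b) \<in> basic_activities \<mu> \<xi>s"
    using p by (auto simp: zero_paths_def simple_paths_def p_eq back_edges_def)
  have eqs: "\<alpha> a + \<beta> b = \<mu> a b" "\<alpha> c + \<beta> d = \<mu> c d" "\<alpha> c + \<beta> b = \<mu> c b"
    using basic nu_pos by (auto intro!: tight simp: psi_star_def basic_activities_def)
  have "(\<mu> a b - \<mu> a d) + (\<mu> c d - \<mu> c b) = 0"
    using p sum_path_edges_two[OF ne mu_nonneg, where f = "\<lambda>_. 1"]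
    by (simp add: zero_paths_def path_weight_def p_eq)
  then have closing: "\<mu> a d = \<alpha> a + \<beta> d" using eqs by linarith
  have "\<mu> a d * \<mu> c b \<le> \<mu> a b * \<mu> c d"
    using basic ne by (intro basic_path_exchange)
  then have "(\<alpha> a - \<alpha> c) * (\<beta> b - \<beta> d) \<le> 0"
    unfolding closing eqs[symmetric] by (simp add: algebra_simps)
  also have "(\<alpha> a - \<alpha> c) * (\<beta> b - \<beta> d)
      = \<alpha> a * (\<mu> a b - \<mu> a d) + \<alpha> c * (\<mu> c d - \<mu> c b)"
    unfolding closing eqs[symmetric] by (simp add: algebra_simps)
  also have "\<dots> = (\<Sum>i\<in>UNIV. \<alpha> i * path_drift \<mu> p i)"
    unfolding sum_path_drift p_eq by (rule sum_path_edges_two[OF ne mu_nonneg, symmetric])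
  finally show ?thesis .
qed

text \<open>
  Complementary slackness: all stations are fully occupied and \<open>\<psi>\<^sup>*\<close> uses all of \<open>x\<^sup>*\<close>, so the
  dual value is the throughput of \<open>\<psi>\<^sup>*\<close> at the rates \<open>\<alpha> i + \<beta> j\<close>, which equal \<open>\<mu> i j\<close> on its support.
\<close>

lemma dual_value_x_star:
  assumes tight: "\<And>i j. psi_star \<nu> \<xi>s i j > 0 \<Longrightarrow> \<alpha> i + \<beta> j = \<mu> i j"
  shows "(\<Sum>i\<in>UNIV. \<alpha> i * x_star \<nu> \<xi>s i) + (\<Sum>j\<in>UNIV. \<beta> j * \<nu> j)
    = throughput \<mu> (psi_star \<nu> \<xi>s)"
proof -
  have split: "\<mu> i j * psi_star \<nu> \<xi>s i j =
      \<alpha> i * psi_star \<nu> \<xi>s i j + \<beta> j * psi_star \<nu> \<xi>s i j" for i j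
  proof (cases "psi_star \<nu> \<xi>s i j = 0")
    case False
    then have "\<alpha> i + \<beta> j = \<mu> i j" using tight psi_star_nonneg[of i j] by simp
    then show ?thesis by (metis distrib_right)
  qed simp
  have "throughput \<mu> (psi_star \<nu> \<xi>s) =
      (\<Sum>i\<in>UNIV. \<Sum>j\<in>UNIV. \<alpha> i * psi_star \<nu> \<xi>s i j)
      + (\<Sum>i\<in>UNIV. \<Sum>j\<in>UNIV. \<beta> j * psi_star \<nu> \<xi>s i j)"
    unfolding throughput_iterated split sum.distrib ..
  also have "(\<Sum>i\<in>UNIV. \<Sum>j\<in>UNIV. \<beta> j * psi_star \<nu> \<xi>s i j)
      = (\<Sum>j\<in>UNIV. \<Sum>i\<in>UNIV. \<beta> j * psi_star \<nu> \<xi>s i j)"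
    by (rule sum.swap)
  finally show ?thesis
    by (simp add: x_star_def psi_star_column flip: sum_distrib_left)
qed

end

theorem theorem3p4:
  fixes lam :: "'i::finite \<Rightarrow> real"
    and \<nu> :: "'j::finite \<Rightarrow> real"
    and \<mu> \<xi>s :: "'i \<Rightarrow> 'j \<Rightarrow> real"
    and \<rho>s :: real
  assumes "static_fluid_model lam \<nu> \<mu> \<xi>s \<rho>s"
    and "throughput_optimal lam \<nu> \<mu> \<xi>s"
    and "CARD('i) = 2 \<or> CARD('j) = 2"
  shows "\<exists>\<delta>>0. \<forall>M :: ('i, 'j) path \<Rightarrow> real.
    (\<forall>p\<in>zero_paths \<mu> \<xi>s. M p \<ge> 0) \<longrightarrow> (\<Sum>p\<in>zero_paths \<mu> \<xi>s. \<bar>M p\<bar>) \<le> \<delta> \<longrightarrow>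
    (let x = (\<lambda>i. x_star \<nu> \<xi>s i + (\<Sum>p\<in>zero_paths \<mu> \<xi>s. path_drift \<mu> p i * M p))
     in \<forall>\<psi>\<in>Xi_alloc x \<nu>. throughput \<mu> \<psi> \<le> throughput \<mu> (psi_star \<nu> \<xi>s))"
proof -
  interpret static_fluid_model lam \<nu> \<mu> \<xi>s \<rho>s by fact
  obtain \<alpha> \<beta> where \<alpha>: "\<And>i. \<alpha> i \<ge> 0" and \<beta>: "\<And>j. \<beta> j \<ge> 0"
    and feas: "\<And>i j. \<mu> i j \<le> \<alpha> i + \<beta> j"
    and tight: "\<And>i j. psi_star \<nu> \<xi>s i j > 0 \<Longrightarrow> \<alpha> i + \<beta> j = \<mu> i j"
    using dual_prices[OF assms(2)] by metis
  have drift: "(\<Sum>i\<in>UNIV. \<alpha> i * path_drift \<mu> p i) \<le> 0" if "p \<in> zero_paths \<mu> \<xi>s" for p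
  proof (rule short_zero_path_dual_drift[OF that _ tight])
    show "length p \<le> 2"
      using that simple_path_length_le[of p \<mu> \<xi>s] assms(3) by (auto simp: zero_paths_def)
  qed
  have bound: "throughput \<mu> \<psi> \<le> throughput \<mu> (psi_star \<nu> \<xi>s)"
    if M: "\<forall>p\<in>zero_paths \<mu> \<xi>s. M p \<ge> 0"
      and \<psi>: "\<psi> \<in> Xi_alloc
        (\<lambda>i. x_star \<nu> \<xi>s i + (\<Sum>p\<in>zero_paths \<mu> \<xi>s. path_drift \<mu> p i * M p)) \<nu>"
    for M and \<psi>
  proof -
    let ?Z = "zero_paths \<mu> \<xi>s"
    have "(\<Sum>i\<in>UNIV. \<alpha> i * (\<Sum>p\<in>?Z. path_drift \<mu> p i * M p))
        = (\<Sum>p\<in>?Z. (\<Sum>i\<in>UNIV. \<alpha> i * path_drift \<mu> p i) * M p)"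
      by (simp add: sum_distrib_left sum_distrib_right mult.assoc sum.swap[of _ ?Z])
    also have "\<dots> \<le> 0"
      using M by (intro sum_nonpos mult_nonpos_nonneg[OF drift]) auto
    finally have "(\<Sum>i\<in>UNIV. \<alpha> i * (\<Sum>p\<in>?Z. path_drift \<mu> p i * M p)) \<le> 0" .
    moreover have "throughput \<mu> \<psi> \<le>
        (\<Sum>i\<in>UNIV. \<alpha> i * (x_star \<nu> \<xi>s i + (\<Sum>p\<in>?Z. path_drift \<mu> p i * M p)))
        + (\<Sum>j\<in>UNIV. \<beta> j * \<nu> j)"
      using \<psi> \<alpha> \<beta> feas by (rule throughput_le_dual_value)
    moreover note dual_value_x_star[of \<alpha> \<beta>, OF tight]
    ultimately show ?thesis by (simp add: distrib_left sum.distrib)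
  qed
  show ?thesis
    unfolding Let_def using bound by (intro exI[of _ 1]) auto
qed

end
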